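(* Let $a,b,c,m$ be real numbers with $m\le a\le c$, and let $f(t)=at^2+2bt(1-t)+c(1-t)^2$ for $0\le t\le1$. Then $$\min_{0\le t\le1}f(t)<m\quad\Longleftrightarrow\quad b<m-\sqrt{(a-m)(c-m)}.$$ Consequently, for the matrix $Q$ described in the context (on the probability-one event that its diagonal entries are distinct) and for $1\le i<j\le n$, there exists $t\in[0,1]$ such that the point $te_{\pi(i)}+(1-t)e_{\pi(j)}$ has objective value $x^\top Qx$ below every vertex value $Q_{rr}$, $1\le r\le n$, if and only if $$X_{ij}<\tau_{ij},\qquad \tau_{ij}:=Z_{(1)}-\sqrt{(Z_{(i)}-Z_{(1)})(Z_{(j)}-Z_{(1)})}.$$
   Context: $Q$ is a random symmetric $n\times n$ matrix ($n\ge2$) with $Q_{ii}\sim N(0,1)$ and $Q_{ij}=Q_{ji}\sim N(0,1/2)$ for $i<j$, all upper-triangular entries (including the diagonal) being independent. $Z_{(1)}\le\cdots\le Z_{(n)}$ are the ordered diagonal entries of $Q$; $\pi$ is the almost surely unique permutation of $\{1,\dots,n\}$ with $Q_{\pi(r)\pi(r)}=Z_{(r)}$ for all $r$; $X_{ij}:=Q_{\pi(i)\pi(j)}$ for $i<j$. $e_r$ is the $r$-th standard basis vector of $\mathbb R^n$. With $a=Z_{(i)}$, $c=Z_{(j)}$, $b=X_{ij}$, the function $f$ is the restriction of $x\mapsto x^\top Qx$ to the segment $t\mapsto te_{\pi(i)}+(1-t)e_{\pi(j)}$. *)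

theory Defs
  imports "HOL-Probability.Probability"
begin

text \<open>The index set of the matrices is a finite linearly ordered type, playing the role of
  \<open>{1..n}\<close> with \<open>n = CARD('n)\<close>; the order only serves to single out the upper triangle.
  Ranks are natural numbers in \<open>{1..n}\<close>. The second argument of \<open>normal_density\<close> is the
  standard deviation.\<close>

definition gaussian_sym_matrix ::
    "'w measure \<Rightarrow> ('w \<Rightarrow> real^'n::{finite,linorder}^'n::{finite,linorder}) \<Rightarrow> bool" where
  "gaussian_sym_matrix M Q \<longleftrightarrow>
     prob_space M \<and>
     (\<forall>\<omega>\<in>space M. transpose (Q \<omega>) = Q \<omega>) \<and>
     (\<forall>i. distributed M lborel (\<lambda>\<omega>. Q \<omega> $ i $ i) (normal_density 0 1)) \<and>
     (\<forall>i j. i < j \<longrightarrow> distributed M lborel (\<lambda>\<omega>. Q \<omega> $ i $ j) (normal_density 0 (sqrt (1/2)))) \<and>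
     prob_space.indep_vars M (\<lambda>_. borel) (\<lambda>(i, j) \<omega>. Q \<omega> $ i $ j) {(i, j). i \<le> j}"

definition objective :: "real^'n^'n \<Rightarrow> real^'n \<Rightarrow> real" where
  "objective A x = x \<bullet> (A *v x)"

definition ordered_diag :: "real^'n^'n \<Rightarrow> nat \<Rightarrow> real" where
  "ordered_diag A r =
     sorted_list_of_multiset (image_mset (\<lambda>k. A $ k $ k) (mset_set UNIV)) ! (r - 1)"

text \<open>Membership in \<open>\<rightarrow>\<^sub>E\<close> fixes the irrelevant values at arguments outside \<open>{1..n}\<close>,
  without which the function could not be unique.\<close>

definition sorts_diag :: "real^'n^'n \<Rightarrow> (nat \<Rightarrow> 'n) \<Rightarrow> bool" where
  "sorts_diag A \<pi> \<longleftrightarrow>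
     \<pi> \<in> {1..CARD('n)} \<rightarrow>\<^sub>E UNIV \<and> bij_betw \<pi> {1..CARD('n)} UNIV \<and>
     (\<forall>r\<in>{1..CARD('n)}. A $ \<pi> r $ \<pi> r = ordered_diag A r)"

definition diag_perm :: "real^'n^'n \<Rightarrow> nat \<Rightarrow> 'n" where
  "diag_perm A = (THE \<pi>. sorts_diag A \<pi>)"

definition reordered_offdiag :: "real^'n^'n \<Rightarrow> nat \<Rightarrow> nat \<Rightarrow> real" where
  "reordered_offdiag A i j = A $ diag_perm A i $ diag_perm A j"

definition threshold :: "real^'n^'n \<Rightarrow> nat \<Rightarrow> nat \<Rightarrow> real" where
  "threshold A i j = ordered_diag A 1 -
     sqrt ((ordered_diag A i - ordered_diag A 1) * (ordered_diag A j - ordered_diag A 1))"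

lemma ex1_sorts_diag:
  fixes A :: "real^'n^'n"
  assumes inj: "inj (\<lambda>k. A $ k $ k)"
  shows "\<exists>!\<pi>. sorts_diag A \<pi>"
proof -
  let ?d = "\<lambda>k. A $ k $ k" and ?n = "CARD('n)"
  define xs where "xs = sorted_list_of_set (range ?d)"
  have Z: "ordered_diag A r = xs ! (r - 1)" for r
    using inj by (simp add: ordered_diag_def xs_def image_mset_mset_set sorted_list_of_mset_set)
  have xs: "distinct xs" "length xs = ?n" "set xs = range ?d"
    using inj by (simp_all add: xs_def card_image)
  define p where "p = restrict (\<lambda>r. inv ?d (xs ! (r - 1))) {1..?n}"
  have b1: "bij_betw (\<lambda>r. r - 1) {1..?n} {..<?n}"
    by (rule bij_betwI[where g = Suc]) auto
  have b2: "bij_betw ((!) xs) {..<?n} (range ?d)"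
    using bij_betw_nth[OF xs(1)] xs by simp
  have b3: "bij_betw (inv ?d) (range ?d) UNIV"
    using inj by (simp add: bij_betw_inv_into inj_imp_bij_betw_inv)
  have "bij_betw (inv ?d \<circ> ((!) xs \<circ> (\<lambda>r. r - 1))) {1..?n} UNIV"
    by (intro bij_betw_trans[OF bij_betw_trans[OF b1 b2] b3])
  then have bij: "bij_betw p {1..?n} UNIV"
    by (rule bij_betw_cong[THEN iffD1, rotated]) (simp add: p_def)
  have "?d (p r) = xs ! (r - 1)" if r: "r \<in> {1..?n}" for r
  proof -
    have "xs ! (r - 1) \<in> range ?d"
      using r xs by (metis atLeastAtMost_iff diff_less le_trans less_le_trans nth_mem zero_less_one)
    then show ?thesis using r by (simp add: p_def f_inv_into_f[where f = ?d])
  qed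
  then have p: "sorts_diag A p"
    using bij by (auto simp: sorts_diag_def Z p_def)
  moreover have "q = p" if q: "sorts_diag A q" for q
  proof (rule PiE_ext)
    show "q \<in> {1..?n} \<rightarrow>\<^sub>E UNIV" "p \<in> {1..?n} \<rightarrow>\<^sub>E UNIV"
      using p q by (auto simp: sorts_diag_def)
    fix r assume "r \<in> {1..?n}"
    then have "?d (q r) = ?d (p r)" using p q by (simp add: sorts_diag_def)
    then show "q r = p r" using inj by (simp add: inj_def)
  qed
  ultimately show ?thesis by blast
qed

end

theory Submission
  imports Defs
begin

text \<open>
  Since \<open>(t + (1 - t))\<^sup>2 = 1\<close>, subtracting the constant \<open>m\<close> from
  \<open>a t\<^sup>2 + 2 b t (1 - t) + c (1 - t)\<^sup>2\<close> replaces the coefficients \<open>a, b, c\<close> by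
  \<open>u = a - m\<close>, \<open>v = b - m\<close>, \<open>w = c - m\<close>. What remains is a criterion for a binary quadratic form
  with \<open>u, w \<ge> 0\<close> to be negative somewhere on the nonnegative quadrant, that is, to fail to be
  copositive: by the inequality of arithmetic and geometric means this happens only if
  \<open>v < - sqrt (u w)\<close>, and then an explicit point of the quadrant shows that it does happen
  (\<open>ex_segment_quadratic_neg_iff\<close>). The minimum on \<open>[0, 1]\<close> is attained by compactness, so being
  below \<open>m\<close> somewhere is the same as having minimum below \<open>m\<close>.

  On the edge joining two vertices the objective of a symmetric matrix is exactly such a quadratic,
  and a value is below all vertex values iff it is below the smallest one, \<open>Z\<^sub>1\<close>. So the matrix
  statement is the scalar one with \<open>m = Z\<^sub>1\<close>; it is deterministic once the diagonal entries are
  distinct (\<open>edge_beats_vertices_iff\<close>). Randomness enters only through the fact that distinctness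
  has probability one: independent random variables, one of which has a Lebesgue density, almost
  surely differ (\<open>AE_indep_var_neq\<close>), and there are finitely many pairs of diagonal entries.
\<close>

section \<open>Almost sure distinctness of the diagonal\<close>

text \<open>By independence the joint law is a product measure, so by Fubini the diagonal of the plane
  has the mass obtained by integrating the masses of single points under the law of \<open>Y\<close>; these
  vanish because \<open>Y\<close> has a density.\<close>

lemma (in prob_space) AE_indep_var_neq:
  fixes X Y :: "'a \<Rightarrow> real"
  assumes indep: "indep_var borel X borel Y" and Y: "distributed M lborel Y f"
  shows "AE \<omega> in M. X \<omega> \<noteq> Y \<omega>"
proof -
  have X_rv: "random_variable borel X" and Y_rv: "random_variable borel Y"
    and joint: "distr M borel X \<Otimes>\<^sub>M distr M borel Y
                  = distr M (borel \<Otimes>\<^sub>M borel) (\<lambda>\<omega>. (X \<omega>, Y \<omega>))"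
    using indep by (simp_all add: indep_var_distribution_eq)
  interpret X: prob_space "distr M borel X" by (rule prob_space_distr[OF X_rv])
  interpret Y: prob_space "distr M borel Y" by (rule prob_space_distr[OF Y_rv])
  interpret XY: pair_sigma_finite "distr M borel X" "distr M borel Y" ..
  have "distr M borel Y = distr M lborel Y"
    by (rule distr_cong) auto
  also have "\<dots> = density lborel f"
    by (rule distributed_distr_eq_density[OF Y])
  finally have Y_density: "distr M borel Y = density lborel f" .
  have no_atom: "AE y in distr M borel Y. x \<noteq> y" for x
    unfolding Y_density AE_density[OF distributed_borel_measurable[OF Y]]
    using AE_lborel_singleton[of x] by eventually_elim simp
  have "{p \<in> space (borel :: (real \<times> real) measure). fst p \<noteq> snd p} \<in> sets borel"
    by (intro borel_measurable_neq borel_measurable_continuous_onI continuous_intros)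
  then have neq_sets: "{p. fst p \<noteq> snd p} \<in> sets (borel \<Otimes>\<^sub>M borel :: (real \<times> real) measure)"
    unfolding borel_prod by simp
  have "AE p in distr M borel X \<Otimes>\<^sub>M distr M borel Y. fst p \<noteq> snd p"
  proof (rule XY.AE_pair_measure)
    have "sets (distr M borel X \<Otimes>\<^sub>M distr M borel Y) = sets (borel \<Otimes>\<^sub>M borel)"
      by (intro sets_pair_measure_cong) simp_all
    with neq_sets show "{p \<in> space (distr M borel X \<Otimes>\<^sub>M distr M borel Y). fst p \<noteq> snd p}
        \<in> sets (distr M borel X \<Otimes>\<^sub>M distr M borel Y)"
      by (simp add: space_pair_measure)
    show "AE x in distr M borel X. AE y in distr M borel Y. fst (x, y) \<noteq> snd (x, y)"
      using no_atom by simp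
  qed
  then have "AE p in distr M (borel \<Otimes>\<^sub>M borel) (\<lambda>\<omega>. (X \<omega>, Y \<omega>)). fst p \<noteq> snd p"
    unfolding joint .
  moreover have "random_variable (borel \<Otimes>\<^sub>M borel) (\<lambda>\<omega>. (X \<omega>, Y \<omega>))"
    using X_rv Y_rv by (rule measurable_Pair)
  ultimately show ?thesis
    using neq_sets by (simp add: AE_distr_iff space_pair_measure)
qed

lemma gaussian_sym_matrix_AE_inj_diag:
  fixes Q :: "'w \<Rightarrow> real^'n::{finite,linorder}^'n::{finite,linorder}"
  assumes "gaussian_sym_matrix M Q"
  shows "AE \<omega> in M. inj (\<lambda>r. Q \<omega> $ r $ r)"
proof -
  interpret prob_space M
    using assms by (simp add: gaussian_sym_matrix_def)
  have "AE \<omega> in M. Q \<omega> $ k $ k \<noteq> Q \<omega> $ l $ l" if "k \<noteq> l" for k l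
  proof (rule AE_indep_var_neq)
    have "indep_vars (\<lambda>_. borel) (\<lambda>(i, j) \<omega>. Q \<omega> $ i $ j) {(i, j). i \<le> j}"
      using assms by (simp add: gaussian_sym_matrix_def)
    \<comment> \<open>Restricting the independent family to two disjoint singleton index sets and evaluating
        the two restrictions turns it into a pair of independent variables.\<close>
    from indep_var_compose[OF indep_var_restrict[OF this, of "{(k, k)}" "{(l, l)}"],
        of "\<lambda>x. x (k, k)" borel "\<lambda>x. x (l, l)" borel]
    show "indep_var borel (\<lambda>\<omega>. Q \<omega> $ k $ k) borel (\<lambda>\<omega>. Q \<omega> $ l $ l)"
      using that by (simp add: o_def measurable_component_singleton)
    show "distributed M lborel (\<lambda>\<omega>. Q \<omega> $ l $ l) (normal_density 0 1)"
      using assms by (simp add: gaussian_sym_matrix_def)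
  qed
  then have "AE \<omega> in M. \<forall>k l. k \<noteq> l \<longrightarrow> Q \<omega> $ k $ k \<noteq> Q \<omega> $ l $ l"
    by (simp add: AE_all_countable)
  then show ?thesis
    by eventually_elim (auto simp: inj_def)
qed

section \<open>Quadratics on the unit interval\<close>

lemma Least_compact_less_iff:
  fixes S :: "real set"
  assumes "compact S" "S \<noteq> {}"
  shows "(LEAST v. v \<in> S) < m \<longleftrightarrow> (\<exists>v\<in>S. v < m)"
proof -
  obtain v where v: "v \<in> S" "\<forall>w\<in>S. v \<le> w"
    using compact_attains_inf[OF assms] by blast
  then have "(LEAST v. v \<in> S) = v"
    by (intro Least_equality) auto
  with v show ?thesis by force
qed

text \<open>The failure of copositivity of the form \<open>u x\<^sup>2 + 2 v x y + w y\<^sup>2\<close>, restricted by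
  homogeneity to \<open>x + y = 1\<close>. Completing the square,
  \<open>u x\<^sup>2 + w y\<^sup>2 \<ge> 2 sqrt (u w) x y\<close>, so a negative value forces \<open>v + sqrt (u w) < 0\<close>.
  Conversely, if \<open>w > 0\<close>, the direction that minimises the form in \<open>y\<close> for fixed \<open>x\<close> is
  \<open>(x, y) = (w, - v)\<close>, and the value there is \<open>w (u w - v\<^sup>2)\<close>.\<close>

lemma ex_segment_quadratic_neg_iff:
  fixes u v w :: real
  assumes "0 \<le> u" "0 \<le> w"
  shows "(\<exists>t\<in>{0..1}. u * t^2 + 2 * v * t * (1 - t) + w * (1 - t)^2 < 0) \<longleftrightarrow> v < - sqrt (u * w)"
    (is "?L \<longleftrightarrow> ?R")
proof
  assume ?L
  then obtain t where t: "0 \<le> t" "t \<le> 1"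
    and neg: "u * t^2 + 2 * v * t * (1 - t) + w * (1 - t)^2 < 0"
    by auto
  have "0 \<le> (sqrt u * t - sqrt w * (1 - t))^2" by simp
  also have "\<dots> = u * t^2 + w * (1 - t)^2 - 2 * sqrt (u * w) * (t * (1 - t))"
    using assms by (simp add: power2_diff power_mult_distrib real_sqrt_mult)
  finally have "2 * (v + sqrt (u * w)) * (t * (1 - t)) < 0"
    using neg by (simp add: algebra_simps)
  moreover have "0 \<le> t * (1 - t)" using t by simp
  ultimately show ?R
    by (smt (verit) mult_nonneg_nonneg)
next
  assume R: ?R
  have "0 \<le> sqrt (u * w)" using assms by simp
  with R have v: "v < 0" by linarith
  \<comment> \<open>Homogeneity: any point of the quadrant other than the origin can be rescaled onto the segment.\<close>
  have neg: ?L if "0 \<le> x" "0 \<le> y" "0 < x + y" "u * x^2 + 2 * v * x * y + w * y^2 < 0" for x y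
  proof
    define t where "t = x / (x + y)"
    have s: "1 - t = y / (x + y)" using that by (simp add: t_def field_simps)
    have "u * t^2 + 2 * v * t * (1 - t) + w * (1 - t)^2
        = (u * x^2 + 2 * v * x * y + w * y^2) / (x + y)^2"
      unfolding s using that by (simp add: t_def power_divide power2_eq_square add_divide_distrib)
    also have "\<dots> < 0" using that by (intro divide_neg_pos) auto
    finally show "u * t^2 + 2 * v * t * (1 - t) + w * (1 - t)^2 < 0" .
    show "t \<in> {0..1}" using that by (simp add: t_def field_simps)
  qed
  show ?L
  proof (cases "w = 0")
    case True
    \<comment> \<open>The form is now \<open>x (u x + 2 v y)\<close>, negative as soon as \<open>y\<close> is large compared with \<open>x\<close>;
        the summand \<open>1\<close> in \<open>u + 1\<close> keeps this strict when \<open>u = 0\<close>.\<close>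
    have "u * (-v)^2 + 2 * v * (-v) * (u + 1) + w * (u + 1)^2 = - (v^2 * (u + 2))"
      using True by (simp add: power2_eq_square algebra_simps)
    also have "\<dots> < 0" using v assms by simp
    finally show ?L using v assms by (intro neg[of "-v" "u + 1"]) auto
  next
    case False
    then have w: "0 < w" using assms by simp
    have "u * w = (sqrt (u * w))^2" using assms by simp
    also have "\<dots> < (-v)^2" using R assms by (intro power_strict_mono) auto
    finally have "w * (u * w - v^2) < 0" using w by (simp add: mult_pos_neg)
    then have "u * w^2 + 2 * v * w * (-v) + w * (-v)^2 < 0"
      by (simp add: power2_eq_square algebra_simps)
    then show ?L using v w by (intro neg[of w "-v"]) auto
  qed
qed

lemma ex_segment_quadratic_less_iff:
  fixes a b c m :: real
  assumes "m \<le> a" "m \<le> c"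
  shows "(\<exists>t\<in>{0..1}. a * t^2 + 2 * b * t * (1 - t) + c * (1 - t)^2 < m)
    \<longleftrightarrow> b < m - sqrt ((a - m) * (c - m))"
proof -
  \<comment> \<open>Homogenise the constant: \<open>m = m (t + (1 - t))\<^sup>2\<close>.\<close>
  have "a * t^2 + 2 * b * t * (1 - t) + c * (1 - t)^2 < m
      \<longleftrightarrow> (a - m) * t^2 + 2 * (b - m) * t * (1 - t) + (c - m) * (1 - t)^2 < 0" for t
    by (simp add: power2_eq_square algebra_simps)
  then show ?thesis
    using ex_segment_quadratic_neg_iff[of "a - m" "c - m" "b - m"] assms by auto
qed

section \<open>The objective on an edge of the simplex\<close>

lemma objective_segment:
  fixes A :: "real^'n^'n"
  assumes "transpose A = A"
  shows "objective A (t *\<^sub>R axis p 1 + (1 - t) *\<^sub>R axis q 1)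
    = (A $ p $ p) * t^2 + 2 * (A $ p $ q) * t * (1 - t) + (A $ q $ q) * (1 - t)^2"
proof -
  have axis: "axis k 1 \<bullet> (A *v axis l 1) = A $ k $ l" for k l
    by (simp add: matrix_vector_mul_component inner_axis inner_axis' matrix_vector_mult_basis column_def)
  have sym: "A $ q $ p = A $ p $ q"
    using assms by (metis transpose_def vec_lambda_beta)
  show ?thesis
    by (simp add: objective_def matrix_vector_right_distrib matrix_vector_mult_scaleR
        inner_add_left inner_add_right axis sym power2_eq_square algebra_simps)
qed

lemma ordered_diag_1_eq_Min:
  fixes A :: "real^'n^'n"
  shows "ordered_diag A 1 = Min (range (\<lambda>k. A $ k $ k))"
proof -
  let ?D = "image_mset (\<lambda>k. A $ k $ k) (mset_set UNIV)"
  let ?L = "sorted_list_of_multiset ?D"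
  have set: "set ?L = range (\<lambda>k. A $ k $ k)" by simp
  then have "?L \<noteq> []" by (metis UNIV_not_empty image_is_empty set_empty)
  then obtain x xs where L: "?L = x # xs" by (cases ?L) auto
  have "sorted (x # xs)" unfolding L[symmetric] by simp
  then have "Min (set ?L) = ?L ! 0" unfolding L by (intro Min_eqI) auto
  then show ?thesis unfolding set ordered_diag_def by simp
qed

lemma sorts_diag_diag_perm:
  fixes A :: "real^'n^'n"
  assumes "inj (\<lambda>k. A $ k $ k)"
  shows "sorts_diag A (diag_perm A)"
  unfolding diag_perm_def by (rule theI'[OF ex1_sorts_diag[OF assms]])

text \<open>Since \<open>Z\<^sub>1\<close> is the smallest diagonal entry, both endpoint values of the edge are at least
  \<open>Z\<^sub>1\<close>, which is what the scalar criterion needs with \<open>m = Z\<^sub>1\<close>.\<close>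

lemma edge_beats_vertices_iff:
  fixes A :: "real^'n^'n"
  assumes sym: "transpose A = A" and inj: "inj (\<lambda>k. A $ k $ k)"
    and ij: "i \<in> {1..CARD('n)}" "j \<in> {1..CARD('n)}"
  shows "(\<exists>t\<in>{0..1}. \<forall>r. objective A (t *\<^sub>R axis (diag_perm A i) 1
                                  + (1 - t) *\<^sub>R axis (diag_perm A j) 1) < A $ r $ r)
    \<longleftrightarrow> reordered_offdiag A i j < threshold A i j"
proof -
  have diag: "A $ diag_perm A r $ diag_perm A r = ordered_diag A r" if "r \<in> {1..CARD('n)}" for r
    using sorts_diag_diag_perm[OF inj] that by (simp add: sorts_diag_def)
  have below_all: "(\<forall>r. y < A $ r $ r) \<longleftrightarrow> y < ordered_diag A 1" for y
    unfolding ordered_diag_1_eq_Min by simp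
  have "ordered_diag A 1 \<le> ordered_diag A r" if "r \<in> {1..CARD('n)}" for r
    unfolding ordered_diag_1_eq_Min diag[OF that, symmetric] by (intro Min_le) auto
  then show ?thesis
    unfolding below_all objective_segment[OF sym] diag[OF ij(1)] diag[OF ij(2)]
      reordered_offdiag_def threshold_def
    using ij by (intro ex_segment_quadratic_less_iff)
qed

theorem proposition4p1:
  fixes M :: "'w measure" and Q :: "'w \<Rightarrow> real^'n::{finite,linorder}^'n::{finite,linorder}"
  shows
    "(\<forall>a b c m :: real. m \<le> a \<and> a \<le> c \<longrightarrow>
        ((LEAST v. v \<in> (\<lambda>t. a * t^2 + 2 * b * t * (1 - t) + c * (1 - t)^2) ` {0..1}) < m
         \<longleftrightarrow> b < m - sqrt ((a - m) * (c - m))))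
     \<and>
     (CARD('n) \<ge> 2 \<and> gaussian_sym_matrix M Q \<longrightarrow>
        (AE \<omega> in M. inj (\<lambda>r. Q \<omega> $ r $ r)) \<and>
        (\<forall>\<omega>\<in>space M. inj (\<lambda>r. Q \<omega> $ r $ r) \<longrightarrow>
          (\<forall>i j. 1 \<le> i \<and> i < j \<and> j \<le> CARD('n) \<longrightarrow>
            ((\<exists>t\<in>{0..1}. \<forall>r. objective (Q \<omega>) (t *\<^sub>R axis (diag_perm (Q \<omega>) i) 1
                                         + (1 - t) *\<^sub>R axis (diag_perm (Q \<omega>) j) 1)
                               < Q \<omega> $ r $ r)
             \<longleftrightarrow> reordered_offdiag (Q \<omega>) i j < threshold (Q \<omega>) i j))))"
proof (intro conjI allI impI ballI)
  fix a b c m :: real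
  assume le: "m \<le> a \<and> a \<le> c"
  let ?S = "(\<lambda>t. a * t^2 + 2 * b * t * (1 - t) + c * (1 - t)^2) ` {0..1}"
  have "compact ?S"
    by (intro compact_continuous_image continuous_intros compact_Icc)
  then show "(LEAST v. v \<in> ?S) < m \<longleftrightarrow> b < m - sqrt ((a - m) * (c - m))"
    using ex_segment_quadratic_less_iff[of m a c b] le by (simp add: Least_compact_less_iff)
next
  assume "CARD('n) \<ge> 2 \<and> gaussian_sym_matrix M Q"
  then show "AE \<omega> in M. inj (\<lambda>r. Q \<omega> $ r $ r)"
    by (simp add: gaussian_sym_matrix_AE_inj_diag)
next
  fix \<omega> i j
  assume "CARD('n) \<ge> 2 \<and> gaussian_sym_matrix M Q" "\<omega> \<in> space M"
    and "inj (\<lambda>r. Q \<omega> $ r $ r)" "1 \<le> i \<and> i < j \<and> j \<le> CARD('n)"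
  then show "(\<exists>t\<in>{0..1}. \<forall>r. objective (Q \<omega>) (t *\<^sub>R axis (diag_perm (Q \<omega>) i) 1
                                         + (1 - t) *\<^sub>R axis (diag_perm (Q \<omega>) j) 1)
                               < Q \<omega> $ r $ r)
             \<longleftrightarrow> reordered_offdiag (Q \<omega>) i j < threshold (Q \<omega>) i j"
    by (intro edge_beats_vertices_iff) (auto simp: gaussian_sym_matrix_def)
qed

end
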